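(* Let $q$ be a power of $2$ with $q\ge 4$. Then the power graph of $\mathrm{PSU}(3,q)$ is not a chordal graph.
   Context: The power graph $\mathcal{P}(G)$ of a group $G$ is the undirected simple graph with vertex set $G$ in which distinct $a,b$ are adjacent iff $a=b^m$ or $b=a^n$ for some positive integers $m,n$. A graph is chordal if it has no induced cycle of length $4$ or more. $\mathrm{PSU}(3,q)$ is the projective special unitary group of degree $3$ defined over the field $GF(q^2)$, i.e. $\mathrm{SU}(3,q)/Z(\mathrm{SU}(3,q))$. *)

theory Defs
  imports "HOL-Analysis.Analysis" "HOL-Algebra.Coset"
begin

text \<open>A simple graph is a pair of a vertex set and a set of two-element edges.\<close>

type_synonym 'a sgraph = "'a set \<times> 'a set set"

definition power_graph :: "('a, 'b) monoid_scheme \<Rightarrow> 'a sgraph" where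
  "power_graph G =
     (carrier G,
      {{a, b} | a b. a \<in> carrier G \<and> b \<in> carrier G \<and> a \<noteq> b \<and>
         ((\<exists>m::nat. m > 0 \<and> a = b [^]\<^bsub>G\<^esub> m) \<or> (\<exists>n::nat. n > 0 \<and> b = a [^]\<^bsub>G\<^esub> n))})"

text \<open>The list \<open>xs\<close> enumerates the vertices of an induced cycle in cyclic order: among these
  vertices, the edges of the graph are exactly those joining cyclically consecutive entries.
  (Meaningful for lists of length at least 3.)\<close>

definition induced_cycle :: "'a sgraph \<Rightarrow> 'a list \<Rightarrow> bool" where
  "induced_cycle \<Gamma> xs \<longleftrightarrow>
     distinct xs \<and> set xs \<subseteq> fst \<Gamma> \<and>
     (\<forall>i < length xs. \<forall>j < length xs.
        {xs ! i, xs ! j} \<in> snd \<Gamma> \<longleftrightarrow>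
          j = Suc i mod length xs \<or> i = Suc j mod length xs)"

definition chordal :: "'a sgraph \<Rightarrow> bool" where
  "chordal \<Gamma> \<longleftrightarrow> \<not> (\<exists>xs. length xs \<ge> 4 \<and> induced_cycle \<Gamma> xs)"

definition group_center :: "('a, 'b) monoid_scheme \<Rightarrow> 'a set" where
  "group_center G = {z \<in> carrier G. \<forall>g \<in> carrier G. z \<otimes>\<^bsub>G\<^esub> g = g \<otimes>\<^bsub>G\<^esub> z}"

text \<open>In the following, \<open>'f\<close> is meant to be a field with \<open>q\<^sup>2\<close> elements, so that \<open>x \<mapsto> x ^ q\<close> is
  its involutory automorphism with fixed field \<open>GF(q)\<close>. The unitary group is taken with respect
  to the standard Hermitian form \<open>\<Sum>i. x\<^sub>i * y\<^sub>i ^ q\<close>.\<close>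

definition conj_transpose :: "nat \<Rightarrow> 'f::field ^ 'n ^ 'n \<Rightarrow> 'f ^ 'n ^ 'n" where
  "conj_transpose q A = transpose (map_matrix (\<lambda>x. x ^ q) A)"

definition SU :: "nat \<Rightarrow> ('f::field ^ 'n ^ 'n) monoid" where
  "SU q = \<lparr>carrier = {A. A ** conj_transpose q A = mat 1 \<and> det A = 1},
           mult = (**), one = mat 1\<rparr>"

definition PSU :: "nat \<Rightarrow> ('f::field ^ 'n ^ 'n) set monoid" where
  "PSU q = SU q Mod group_center (SU q)"

end

theory Submission
  imports Defs "HOL-Number_Theory.Residues"
begin

text \<open>If \<open>t\<close> and \<open>h\<close> commute and have coprime orders, then both are powers of \<open>t h\<close>, so
  \<open>t\<close>, \<open>t h\<close>, \<open>h\<close> is a path in the power graph. A closed chain of commuting pairs of this kind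
  therefore gives a cycle, and the geometry of the Hermitian plane provides one of length six.

  For an isotropic vector \<open>w\<close> in characteristic 2, the transvection
  \<open>x \<mapsto> x + \<langle>x, w\<rangle> w\<close> is a unitary involution. For a vector \<open>u\<close> of norm 1 and \<open>a ^ (q + 1) = 1\<close>,
  the homology that acts as \<open>a\<close> on the complement of \<open>u\<close> and as \<open>1 / a\<^sup>2\<close> on \<open>u\<close> lies in
  the special unitary group and has order dividing the odd number \<open>q + 1\<close>; it is not scalar if
  \<open>a ^ 3 \<noteq> 1\<close>, and such an \<open>a\<close> exists because \<open>q + 1 > 3\<close>.
  A transvection and a non-scalar homology commute exactly if \<open>w\<close> and \<open>u\<close> are orthogonal
  (\<open>rank_one_pert_commute_iff\<close>). Now take a triangle of isotropic points \<open>w\<^sub>0, w\<^sub>1, w\<^sub>2\<close> and let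
  \<open>u\<^sub>i\<close> be orthogonal to the side opposite \<open>w\<^sub>i\<close>. The transvections \<open>t\<^sub>i\<close> and the homologies \<open>h\<^sub>j\<close>
  satisfy: \<open>t\<^sub>i\<close> commutes with \<open>h\<^sub>j\<close> exactly if \<open>i \<noteq> j\<close>. This is the hexagon
  \<open>t\<^sub>0, h\<^sub>2, t\<^sub>1, h\<^sub>0, t\<^sub>2, h\<^sub>1\<close>, and with the six products of neighbours it becomes a cycle
  of length 12.

  The cycle has no chords. Because the orders are coprime, one product is a power of another
  exactly if this holds for both factors (\<open>product_power_iff\<close>), and \<open>h\<^sub>i\<close> cannot be a power of
  \<open>h\<^sub>j\<close> for \<open>j \<noteq> i\<close>, since \<open>t\<^sub>i\<close> commutes with \<open>h\<^sub>j\<close> but not with \<open>h\<^sub>i\<close>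
  (\<open>opt_elem_power_iff\<close>). So the commutation pattern alone determines the induced subgraph
  (\<open>power_graph_not_chordal\<close>), and the pattern survives division by the centre: if a commutator
  of elements of coprime orders is central, its order divides both of them and it is trivial
  (\<open>commute_if_commute_mod_center\<close>).\<close>

section \<open>Commuting elements of coprime orders\<close>

text \<open>By Bezout there is an exponent that is 1 modulo \<open>m\<close> and 0 modulo \<open>n\<close>. It extracts
  one factor from a product of commuting elements of coprime orders.\<close>

lemma (in group) coprime_exponent:
  fixes m n :: nat
  assumes "coprime m n" and "n > 0"
  obtains e :: nat where "e > 0"
    and "\<And>x. x \<in> carrier G \<Longrightarrow> x [^] m = \<one> \<Longrightarrow> x [^] e = x"
    and "\<And>x. x \<in> carrier G \<Longrightarrow> x [^] n = \<one> \<Longrightarrow> x [^] e = \<one>"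
proof -
  obtain c d where cd: "n * c = m * d + 1"
    using bezout_nat[of n m] assms by (auto simp: gcd.commute coprime_iff_gcd_eq_1)
  show ?thesis
  proof (rule that)
    show "n * c > 0" using cd by simp
  next
    fix x assume x: "x \<in> carrier G" "x [^] m = \<one>"
    have "x [^] (n * c) = (x [^] m) [^] d \<otimes> x"
      using x(1) by (simp only: cd nat_pow_pow) simp
    then show "x [^] (n * c) = x" using x by simp
  next
    fix x assume x: "x \<in> carrier G" "x [^] n = \<one>"
    have "x [^] (n * c) = (x [^] n) [^] c"
      using x(1) by (simp add: nat_pow_pow)
    then show "x [^] (n * c) = \<one>" using x by simp
  qed
qed

text \<open>Raising to the exponents of the preceding lemma separates the factors of a power of
  \<open>x' \<otimes> y'\<close>; conversely, combining the two exponents prescribes the powers of \<open>x'\<close> and \<open>y'\<close>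
  independently.\<close>

lemma (in group) product_power_iff:
  fixes m n :: nat
  assumes "coprime m n" "m > 0" "n > 0"
    and G: "x \<in> carrier G" "y \<in> carrier G" "x' \<in> carrier G" "y' \<in> carrier G"
    and xy: "x \<otimes> y = y \<otimes> x" and xy': "x' \<otimes> y' = y' \<otimes> x'"
    and m: "x [^] m = \<one>" "x' [^] m = \<one>" and n: "y [^] n = \<one>" "y' [^] n = \<one>"
  shows "(\<exists>k::nat. k > 0 \<and> x \<otimes> y = (x' \<otimes> y') [^] k) \<longleftrightarrow>
    (\<exists>k::nat. k > 0 \<and> x = x' [^] k) \<and> (\<exists>k::nat. k > 0 \<and> y = y' [^] k)"
proof -
  obtain e :: nat where e: "e > 0"
    "\<And>x. x \<in> carrier G \<Longrightarrow> x [^] m = \<one> \<Longrightarrow> x [^] e = x"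
    "\<And>x. x \<in> carrier G \<Longrightarrow> x [^] n = \<one> \<Longrightarrow> x [^] e = \<one>"
    using coprime_exponent[of m n] assms by metis
  obtain f :: nat where f: "f > 0"
    "\<And>x. x \<in> carrier G \<Longrightarrow> x [^] n = \<one> \<Longrightarrow> x [^] f = x"
    "\<And>x. x \<in> carrier G \<Longrightarrow> x [^] m = \<one> \<Longrightarrow> x [^] f = \<one>"
    using coprime_exponent[of n m] assms by (metis coprime_commute)
  show ?thesis
  proof (intro iffI conjI; (elim conjE exE)?)
    fix k :: nat assume k: "k > 0" "x \<otimes> y = (x' \<otimes> y') [^] k"
    have pow: "(x \<otimes> y) [^] i = ((x' \<otimes> y') [^] i) [^] k" for i :: nat
      using G by (simp add: k(2) nat_pow_pow mult.commute)
    have "x = x' [^] k"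
      using pow[of e] e G m n by (simp add: pow_mult_distrib xy xy')
    then show "\<exists>k::nat. k > 0 \<and> x = x' [^] k" using k by blast
    have "y = y' [^] k"
      using pow[of f] f G m n by (simp add: pow_mult_distrib xy xy')
    then show "\<exists>k::nat. k > 0 \<and> y = y' [^] k" using k by blast
  next
    fix k l :: nat
    assume k: "k > 0" "x = x' [^] k" and l: "y = y' [^] l"
    have "x' [^] (e * k + f * l) = x"
      using G e(2)[of x'] f(3)[of x'] m k by (simp flip: nat_pow_mult nat_pow_pow)
    moreover have "y' [^] (e * k + f * l) = y"
      using G e(3)[of y'] f(2)[of y'] n l by (simp flip: nat_pow_mult nat_pow_pow)
    ultimately have "x \<otimes> y = (x' \<otimes> y') [^] (e * k + f * l)"
      using G pow_mult_distrib[OF xy'] by simp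
    then show "\<exists>k::nat. k > 0 \<and> x \<otimes> y = (x' \<otimes> y') [^] k"
      using k e(1) by (metis add_pos_nonneg mult_pos_pos zero_le)
  qed
qed

lemma (in group) inv_commutes:
  assumes "x \<in> carrier G" "y \<in> carrier G" "x \<otimes> y = y \<otimes> x"
  shows "inv x \<otimes> y = y \<otimes> inv x"
proof -
  have "inv x \<otimes> y \<otimes> x = inv x \<otimes> (x \<otimes> y)"
    using assms by (simp add: m_assoc)
  also have "\<dots> = y"
    using assms(1,2) by (simp flip: m_assoc)
  finally show ?thesis
    using assms(1,2) inv_solve_right[of "inv x \<otimes> y" y x] by simp
qed

text \<open>A central commutator is multiplicative in either argument. Hence its order divides the
  orders of both arguments, which the next lemma exploits.\<close>

lemma (in group) power_shift_central:
  fixes k :: nat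
  assumes "x \<in> carrier G" "y \<in> carrier G" "z \<in> carrier G"
    and "\<And>g. g \<in> carrier G \<Longrightarrow> z \<otimes> g = g \<otimes> z"
    and "x \<otimes> y = z \<otimes> (y \<otimes> x)"
  shows "x [^] k \<otimes> y = z [^] k \<otimes> (y \<otimes> x [^] k)"
proof (induction k)
  case (Suc k)
  have "x [^] Suc k \<otimes> y = x [^] k \<otimes> z \<otimes> (y \<otimes> x)"
    using assms by (simp add: m_assoc)
  also have "\<dots> = z \<otimes> (x [^] k \<otimes> y) \<otimes> x"
    using assms(1-3) assms(4)[of "x [^] k"] by (simp add: m_assoc[symmetric])
  also have "\<dots> = z [^] Suc k \<otimes> (y \<otimes> x [^] Suc k)"
    using assms(1-3) assms(4)[of "z [^] k"] by (simp add: Suc m_assoc[symmetric])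
  finally show ?case .
qed (use assms in simp)

lemma (in group) commute_if_commute_mod_center:
  fixes m n :: nat
  assumes "coprime m n" "n > 0"
    and x: "x \<in> carrier G" "x [^] m = \<one>" and y: "y \<in> carrier G" "y [^] n = \<one>"
    and z: "z \<in> group_center G" and xy: "x \<otimes> y = z \<otimes> (y \<otimes> x)"
  shows "x \<otimes> y = y \<otimes> x"
proof -
  have zG: "z \<in> carrier G" and zc: "\<And>g. g \<in> carrier G \<Longrightarrow> z \<otimes> g = g \<otimes> z"
    using z by (auto simp: group_center_def)
  have iz: "inv z \<otimes> g = g \<otimes> inv z" if "g \<in> carrier G" for g
    using inv_commutes[OF zG that zc[OF that]] .
  have yx: "y \<otimes> x = inv z \<otimes> (x \<otimes> y)"
    using xy zG x y by (simp add: m_assoc[symmetric])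
  have "y = z [^] m \<otimes> y"
    using power_shift_central[OF x(1) y(1) zG zc xy, of m] x y zG by simp
  then have zm: "z [^] m = \<one>"
    using y zG by (simp add: r_cancel_one')
  have "x = inv z [^] n \<otimes> x"
    using power_shift_central[OF y(1) x(1) _ iz yx, of n] x y zG by simp
  then have "inv z [^] n = \<one>"
    using x zG by (simp add: r_cancel_one')
  then have zn: "z [^] n = \<one>"
    using zG by (simp add: nat_pow_inv)
  obtain e :: nat where "z [^] e = z" "z [^] e = \<one>"
    using coprime_exponent[OF assms(1,2)] zG zm zn by metis
  then have "z = \<one>" by simp
  then show ?thesis using xy x y by simp
qed

section \<open>A twelve-cycle in a power graph\<close>

text \<open>The vertices of the cycle are products of at most one \<open>t\<^sub>i\<close> and at most one \<open>h\<^sub>j\<close>; a missing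
  factor is recorded as \<open>None\<close>, so that the three kinds of vertices are treated uniformly. The
  label \<open>(b, c)\<close> stands for \<open>opt_elem t b \<otimes> opt_elem h c\<close>.\<close>

definition (in monoid) opt_elem :: "(nat \<Rightarrow> 'a) \<Rightarrow> nat option \<Rightarrow> 'a" where
  "opt_elem x i = (case i of None \<Rightarrow> \<one> | Some i \<Rightarrow> x i)"

definition cycle_labels :: "(nat option \<times> nat option) list" where
  "cycle_labels =
    [(Some 0, None), (Some 0, Some 2), (None, Some 2), (Some 1, Some 2),
     (Some 1, None), (Some 1, Some 0), (None, Some 0), (Some 2, Some 0),
     (Some 2, None), (Some 2, Some 1), (None, Some 1), (Some 0, Some 1)]"

text \<open>The order on labels that corresponds, on the vertices, to the first being a power of the second
  (\<open>v_power\<close> in the proof of \<open>power_graph_not_chordal\<close>).\<close>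

definition label_le :: "nat option \<times> nat option \<Rightarrow> nat option \<times> nat option \<Rightarrow> bool" where
  "label_le p r \<longleftrightarrow> (fst p = None \<or> fst p = fst r) \<and> (snd p = None \<or> snd p = snd r)"

lemma cycle_labels_induced:
  "\<forall>i<12. \<forall>j<12.
    cycle_labels ! i \<noteq> cycle_labels ! j \<and>
      (label_le (cycle_labels ! i) (cycle_labels ! j) \<or>
       label_le (cycle_labels ! j) (cycle_labels ! i)) \<longleftrightarrow>
    j = Suc i mod 12 \<or> i = Suc j mod 12"
  by code_simp

text \<open>The elements \<open>y i\<close> act as detectors: everything that commutes with \<open>x c\<close> commutes with its
  powers, but \<open>y i\<close> does not commute with \<open>x i\<close>. This shows at the same time that no \<open>x i\<close> is
  trivial. The statement is symmetric in the two families and is used both ways.\<close>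

lemma (in group) opt_elem_power_iff:
  fixes m :: nat
  assumes x: "\<And>i. i < r \<Longrightarrow> x i \<in> carrier G" "\<And>i. i < r \<Longrightarrow> x i [^] m = \<one>" and "m > 0"
    and y: "\<And>i. i < r \<Longrightarrow> y i \<in> carrier G"
    and comm: "\<And>i j. i < r \<Longrightarrow> j < r \<Longrightarrow> x i \<otimes> y j = y j \<otimes> x i \<longleftrightarrow> i \<noteq> j"
    and b: "set_option b \<subseteq> {..<r}" "set_option c \<subseteq> {..<r}"
  shows "(\<exists>k::nat. k > 0 \<and> opt_elem x b = opt_elem x c [^] k) \<longleftrightarrow> b = None \<or> b = c"
proof
  assume "\<exists>k::nat. k > 0 \<and> opt_elem x b = opt_elem x c [^] k"
  then obtain k :: nat where k: "opt_elem x b = opt_elem x c [^] k" by blast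
  show "b = None \<or> b = c"
  proof (cases b)
    case (Some i)
    have i: "i < r" using b Some by simp
    have "c = Some i"
    proof (rule ccontr)
      assume "c \<noteq> Some i"
      then have c: "opt_elem x c \<in> carrier G" "opt_elem x c \<otimes> y i = y i \<otimes> opt_elem x c"
        using b(2) i x(1) y comm[OF _ i] by (auto simp: opt_elem_def split: option.split)
      have "x i \<otimes> y i = y i \<otimes> x i"
        using group_commutes_pow[OF c(2,1) y[OF i], of k] k Some by (simp add: opt_elem_def)
      then show False using comm i by blast
    qed
    then show ?thesis using Some by simp
  qed simp
next
  assume bc: "b = None \<or> b = c"
  have "opt_elem x c \<in> carrier G" "opt_elem x c [^] m = \<one>"
    using b(2) x by (auto simp: opt_elem_def split: option.split)
  then show "\<exists>k::nat. k > 0 \<and> opt_elem x b = opt_elem x c [^] k"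
    using bc \<open>m > 0\<close> by (auto simp: opt_elem_def[of x None] intro: exI[of _ m] exI[of _ "1::nat"])
qed

lemma (in group) power_graph_not_chordal:
  fixes m n :: nat
  assumes mn: "coprime m n" "m > 0" "n > 0"
    and t: "\<And>i. i < 3 \<Longrightarrow> t i \<in> carrier G" "\<And>i. i < 3 \<Longrightarrow> t i [^] m = \<one>"
    and h: "\<And>i. i < 3 \<Longrightarrow> h i \<in> carrier G" "\<And>i. i < 3 \<Longrightarrow> h i [^] n = \<one>"
    and comm: "\<And>i j::nat. i < 3 \<Longrightarrow> j < 3 \<Longrightarrow> t i \<otimes> h j = h j \<otimes> t i \<longleftrightarrow> i \<noteq> j"
  shows "\<not> chordal (power_graph G)"
proof -
  define v where "v p = opt_elem t (fst p) \<otimes> opt_elem h (snd p)" for p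
  define good where "good p \<longleftrightarrow> set_option (fst p) \<subseteq> {..<3} \<and> set_option (snd p) \<subseteq> {..<3} \<and>
    (fst p = None \<or> fst p \<noteq> snd p)" for p :: "nat option \<times> nat option"
  have opt: "opt_elem t b \<in> carrier G" "opt_elem h b \<in> carrier G"
    "opt_elem t b [^] m = \<one>" "opt_elem h b [^] n = \<one>" if "set_option b \<subseteq> {..<3}" for b
    using that t h by (auto simp: opt_elem_def split: option.split)
  have opt_comm: "opt_elem t (fst p) \<otimes> opt_elem h (snd p) = opt_elem h (snd p) \<otimes> opt_elem t (fst p)"
    if "good p" for p
    using that t h comm by (auto simp: good_def opt_elem_def split: option.split)
  have comm': "h i \<otimes> t j = t j \<otimes> h i \<longleftrightarrow> i \<noteq> j" if "i < 3" "j < 3" for i j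
    using comm[OF that(2,1)] by metis
  have v_closed: "v p \<in> carrier G" if "good p" for p
    using that opt by (simp add: v_def good_def)
  have v_power: "(\<exists>k::nat. k > 0 \<and> v p = v r [^] k) \<longleftrightarrow> label_le p r" if "good p" "good r" for p r
  proof -
    have "(\<exists>k::nat. k > 0 \<and> v p = v r [^] k) \<longleftrightarrow>
      (\<exists>k::nat. k > 0 \<and> opt_elem t (fst p) = opt_elem t (fst r) [^] k) \<and>
      (\<exists>k::nat. k > 0 \<and> opt_elem h (snd p) = opt_elem h (snd r) [^] k)"
      unfolding v_def
      using that by (intro product_power_iff[OF mn]) (simp_all add: good_def opt opt_comm)
    also have "\<dots> \<longleftrightarrow> label_le p r"
      using opt_elem_power_iff[of 3 t m h "fst p" "fst r", OF t mn(2) h(1) comm]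
        opt_elem_power_iff[of 3 h n t "snd p" "snd r", OF h mn(3) t(1) comm'] that
      by (simp add: label_le_def good_def)
    finally show ?thesis .
  qed
  have v_eq: "v p = v r \<longleftrightarrow> p = r" if "good p" "good r" for p r
  proof
    assume "v p = v r"
    then have "v p = v r [^] (1::nat)" "v r = v p [^] (1::nat)"
      using v_closed that by simp_all
    then have "label_le p r" "label_le r p"
      using v_power that by (metis zero_less_one)+
    then show "p = r" by (auto simp: label_le_def prod_eq_iff)
  qed simp
  have edge: "{v p, v r} \<in> snd (power_graph G) \<longleftrightarrow> p \<noteq> r \<and> (label_le p r \<or> label_le r p)"
    if "good p" "good r" for p r
    using v_power[OF that] v_power[OF that(2,1)] v_eq[OF that] v_closed[OF that(1)] v_closed[OF that(2)]
    unfolding power_graph_def by (auto simp: doubleton_eq_iff)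
  have good: "good p" if "p \<in> set cycle_labels" for p
    using that by (auto simp: cycle_labels_def good_def)
  have len: "length cycle_labels = 12" by (simp add: cycle_labels_def)
  have "induced_cycle (power_graph G) (map v cycle_labels)"
    unfolding induced_cycle_def
  proof (intro conjI)
    show "distinct (map v cycle_labels)"
      using v_eq good by (auto simp: distinct_map inj_on_def) (simp add: cycle_labels_def)
    show "set (map v cycle_labels) \<subseteq> fst (power_graph G)"
      using v_closed good by (auto simp: power_graph_def)
    show "\<forall>i<length (map v cycle_labels). \<forall>j<length (map v cycle_labels).
      ({map v cycle_labels ! i, map v cycle_labels ! j} \<in> snd (power_graph G)) =
      (j = Suc i mod length (map v cycle_labels) \<or> i = Suc j mod length (map v cycle_labels))"
      using cycle_labels_induced by (simp add: len edge good)
  qed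
  then show ?thesis
    unfolding chordal_def not_not using len by (intro exI[of _ "map v cycle_labels"]) simp
qed

lemma (in group) group_center_normal: "group_center G \<lhd> G"
proof -
  have closed: "x \<in> carrier G" if "x \<in> group_center G" for x
    using that by (simp add: group_center_def)
  have comm: "x \<otimes> g = g \<otimes> x" if "x \<in> group_center G" "g \<in> carrier G" for x g
    using that by (auto simp: group_center_def)
  have "subgroup (group_center G) G"
  proof
    fix x y assume x: "x \<in> group_center G" and y: "y \<in> group_center G"
    have "x \<otimes> y \<otimes> g = g \<otimes> (x \<otimes> y)" if g: "g \<in> carrier G" for g
    proof -
      have "x \<otimes> y \<otimes> g = x \<otimes> g \<otimes> y"
        using comm[OF y g] closed[OF x] closed[OF y] g by (metis m_assoc)
      then show ?thesis
        using comm[OF x g] closed[OF x] closed[OF y] g by (metis m_assoc)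
    qed
    then show "x \<otimes> y \<in> group_center G"
      unfolding group_center_def using closed[OF x] closed[OF y] by blast
  next
    fix x assume x: "x \<in> group_center G"
    then show "inv x \<in> group_center G"
      unfolding group_center_def using inv_commutes by blast
  next
    show "\<one> \<in> group_center G" by (simp add: group_center_def)
  qed (use closed in blast)
  moreover have "g \<otimes> x \<otimes> inv g \<in> group_center G"
    if x: "x \<in> group_center G" and g: "g \<in> carrier G" for x g
  proof -
    have "g \<otimes> x \<otimes> inv g = x \<otimes> g \<otimes> inv g"
      using comm[OF x g] by metis
    then have "g \<otimes> x \<otimes> inv g = x"
      using closed[OF x] g by (simp add: m_assoc)
    then show ?thesis using x by metis
  qed
  ultimately show ?thesis by (simp add: normal_inv_iff)
qed

text \<open>The cosets of \<open>t\<close> and \<open>h\<close> inherit the orders, and by \<open>commute_if_commute_mod_center\<close>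
  they commute only if the representatives do.\<close>

lemma (in group) power_graph_mod_center_not_chordal:
  fixes m n :: nat
  assumes mn: "coprime m n" "m > 0" "n > 0"
    and t: "\<And>i. i < 3 \<Longrightarrow> t i \<in> carrier G" "\<And>i. i < 3 \<Longrightarrow> t i [^] m = \<one>"
    and h: "\<And>i. i < 3 \<Longrightarrow> h i \<in> carrier G" "\<And>i. i < 3 \<Longrightarrow> h i [^] n = \<one>"
    and comm: "\<And>i j::nat. i < 3 \<Longrightarrow> j < 3 \<Longrightarrow> t i \<otimes> h j = h j \<otimes> t i \<longleftrightarrow> i \<noteq> j"
  shows "\<not> chordal (power_graph (G Mod group_center G))"
proof -
  let ?Z = "group_center G"
  interpret Z: normal ?Z G by (rule group_center_normal)
  interpret Q: group "G Mod ?Z" by (rule Z.factorgroup_is_group)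
  interpret pi: group_hom G "G Mod ?Z" "\<lambda>x. ?Z #> x"
    by unfold_locales (rule Z.r_coset_hom_Mod)
  show ?thesis
  proof (rule Q.power_graph_not_chordal[OF mn])
    fix i :: nat assume "i < 3"
    then show "?Z #> t i \<in> carrier (G Mod ?Z)" "?Z #> h i \<in> carrier (G Mod ?Z)"
      using t h by (blast intro: pi.hom_closed)+
    show "(?Z #> t i) [^]\<^bsub>G Mod ?Z\<^esub> m = \<one>\<^bsub>G Mod ?Z\<^esub>"
      "(?Z #> h i) [^]\<^bsub>G Mod ?Z\<^esub> n = \<one>\<^bsub>G Mod ?Z\<^esub>"
      using \<open>i < 3\<close> t h by (metis pi.hom_nat_pow pi.hom_one)+
  next
    fix i j :: nat assume ij: "i < 3" "j < 3"
    note G = t(1)[OF ij(1)] h(1)[OF ij(2)]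
    have "(?Z #> t i) \<otimes>\<^bsub>G Mod ?Z\<^esub> (?Z #> h j) = (?Z #> h j) \<otimes>\<^bsub>G Mod ?Z\<^esub> (?Z #> t i) \<longleftrightarrow>
      ?Z #> (t i \<otimes> h j) = ?Z #> (h j \<otimes> t i)"
      using G by (metis pi.hom_mult)
    also have "\<dots> \<longleftrightarrow> t i \<otimes> h j = h j \<otimes> t i"
    proof
      assume "?Z #> (t i \<otimes> h j) = ?Z #> (h j \<otimes> t i)"
      then have "t i \<otimes> h j \<in> ?Z #> (h j \<otimes> t i)"
        using G Z.subgroup_axioms by (metis rcos_self m_closed)
      then obtain z where "z \<in> ?Z" "t i \<otimes> h j = z \<otimes> (h j \<otimes> t i)"
        by (auto simp: r_coset_def)
      then show "t i \<otimes> h j = h j \<otimes> t i"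
        using commute_if_commute_mod_center[OF mn(1,3)] t h ij by metis
    qed simp
    finally show "(?Z #> t i) \<otimes>\<^bsub>G Mod ?Z\<^esub> (?Z #> h j) = (?Z #> h j) \<otimes>\<^bsub>G Mod ?Z\<^esub> (?Z #> t i) \<longleftrightarrow>
      i \<noteq> j"
      using comm ij by simp
  qed
qed

section \<open>The special unitary group\<close>

text \<open>The properties of \<open>x \<mapsto> x ^ q\<close> on which Hermitian forms rely. The parameter \<open>ty\<close>
  only makes the field explicit in interpretations.\<close>

locale unitary_field =
  fixes q :: nat and ty :: "'f::field itself"
  assumes power_add: "\<And>x y :: 'f. (x + y) ^ q = x ^ q + y ^ q"
    and power_power: "\<And>x :: 'f. (x ^ q) ^ q = x"
begin

lemma q_pos: "q > 0"
proof (rule ccontr)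
  assume "\<not> q > 0"
  then show False using power_power[of 0] by simp
qed

lemma power_sum: "(\<Sum>i\<in>I. g i :: 'f) ^ q = (\<Sum>i\<in>I. g i ^ q)"
  by (induction I rule: infinite_finite_induct) (use q_pos power_add in auto)

lemma power_diff: "(x - y :: 'f) ^ q = x ^ q - y ^ q"
  using power_add[of "x - y" y] by (simp add: algebra_simps)

lemma conj_transpose_mult:
  fixes A B :: "'f ^ 'n::finite ^ 'n"
  shows "conj_transpose q (A ** B) = conj_transpose q B ** conj_transpose q A"
  by (simp add: conj_transpose_def matrix_matrix_mult_def transpose_def map_matrix_def
      vec_eq_iff power_sum power_mult_distrib mult.commute)

lemma conj_transpose_conj_transpose:
  fixes A :: "'f ^ 'n::finite ^ 'n"
  shows "conj_transpose q (conj_transpose q A) = A"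
  by (simp add: conj_transpose_def transpose_def map_matrix_def vec_eq_iff power_power)

lemma conj_transpose_one: "conj_transpose q (mat 1 :: 'f ^ 'n::finite ^ 'n) = mat 1"
  using q_pos by (auto simp: conj_transpose_def transpose_def map_matrix_def mat_def vec_eq_iff)

lemma group_SU: "group (SU q :: ('f ^ 'n::finite ^ 'n) monoid)"
proof (rule groupI)
  fix A B :: "'f ^ 'n ^ 'n"
  assume A: "A \<in> carrier (SU q)" and B: "B \<in> carrier (SU q)"
  have "A ** B ** (conj_transpose q B ** conj_transpose q A) =
    A ** (B ** conj_transpose q B) ** conj_transpose q A"
    by (simp only: matrix_mul_assoc)
  then show "A \<otimes>\<^bsub>SU q\<^esub> B \<in> carrier (SU q)"
    using A B by (simp add: SU_def conj_transpose_mult det_mul)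
next
  fix A :: "'f ^ 'n ^ 'n"
  assume A: "A \<in> carrier (SU q)"
  then have inv: "conj_transpose q A ** A = mat 1"
    by (simp add: SU_def matrix_left_right_inverse)
  then have "det (conj_transpose q A) * det A = 1"
    by (metis det_I det_mul)
  then have "conj_transpose q A \<in> carrier (SU q)"
    using A inv by (simp add: SU_def conj_transpose_conj_transpose)
  then show "\<exists>B\<in>carrier (SU q). B \<otimes>\<^bsub>SU q\<^esub> A = \<one>\<^bsub>SU q\<^esub>"
    using inv by (auto simp: SU_def)
qed (simp_all add: SU_def conj_transpose_one matrix_mul_assoc)

end

section \<open>Scalar plus rank one\<close>

definition herm :: "nat \<Rightarrow> 'f::field ^ 'n \<Rightarrow> 'f ^ 'n \<Rightarrow> 'f" where
  "herm q u v = (\<Sum>i\<in>UNIV. u $ i * (v $ i) ^ q)"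

text \<open>The matrix of \<open>x \<mapsto> a x + b \<langle>x, u\<rangle> u\<close> for the Hermitian form \<open>herm q\<close>. Transvections
  and homologies are both of this kind.\<close>

definition rank_one_pert :: "nat \<Rightarrow> 'f \<Rightarrow> 'f \<Rightarrow> 'f::field ^ 'n \<Rightarrow> 'f ^ 'n ^ 'n" where
  "rank_one_pert q a b u = (\<chi> i j. (if i = j then a else 0) + b * u $ i * (u $ j) ^ q)"

lemma rank_one_pert_mult_nth:
  fixes u w :: "'f::field ^ 'n::finite"
  shows "(rank_one_pert q a b u ** rank_one_pert q c d w) $ i $ j =
    (if i = j then a * c else 0) + a * d * w $ i * (w $ j) ^ q + b * c * u $ i * (u $ j) ^ q
      + b * d * herm q w u * u $ i * (w $ j) ^ q"
proof -
  have "(rank_one_pert q a b u ** rank_one_pert q c d w) $ i $ j =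
    (\<Sum>k\<in>UNIV. (if i = k then a * ((if k = j then c else 0) + d * w $ k * (w $ j) ^ q) else 0)
      + (if k = j then b * u $ i * (u $ k) ^ q * c else 0)
      + b * d * (w $ k * (u $ k) ^ q) * (u $ i * (w $ j) ^ q))"
    by (auto simp: matrix_matrix_mult_def rank_one_pert_def algebra_simps intro!: sum.cong)
  then show ?thesis
    by (simp add: sum.distrib herm_def flip: sum_distrib_left sum_distrib_right) (simp add: algebra_simps)
qed

lemma rank_one_pert_mult:
  fixes u :: "'f::field ^ 'n::finite"
  shows "rank_one_pert q a b u ** rank_one_pert q c d u =
    rank_one_pert q (a * c) (a * d + b * c + b * d * herm q u u) u"
  by (simp add: vec_eq_iff rank_one_pert_mult_nth) (simp add: rank_one_pert_def algebra_simps)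

lemma rank_one_pert_one: "rank_one_pert q 1 0 u = mat 1"
  by (simp add: rank_one_pert_def mat_def vec_eq_iff)

lemma det_rank_one_pert:
  fixes u :: "'f::field ^ 3"
  shows "det (rank_one_pert q a b u) = a ^ 2 * (a + b * herm q u u)"
  by (simp add: det_3 rank_one_pert_def herm_def sum_3 algebra_simps power2_eq_square)

context unitary_field
begin

lemma conj_transpose_rank_one_pert:
  fixes u :: "'f ^ 'n::finite"
  shows "conj_transpose q (rank_one_pert q a b u) = rank_one_pert q (a ^ q) (b ^ q) u"
  using q_pos
  by (auto simp: conj_transpose_def transpose_def map_matrix_def rank_one_pert_def vec_eq_iff
      power_add power_mult_distrib power_power)

lemma herm_swap: "herm q v u = herm q u v ^ q" for u v :: "'f ^ 'n::finite"
  by (simp add: herm_def power_sum power_mult_distrib power_power mult.commute)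

text \<open>If \<open>\<langle>w, u\<rangle> = 0\<close>, the two rank one parts annihilate each other. Otherwise, commuting would
  make \<open>u\<close> and \<open>w\<close> proportional entry by entry; pairing this relation with \<open>w\<close> kills one
  side, because \<open>w\<close> is isotropic, but not the other.\<close>

lemma rank_one_pert_commute_iff:
  fixes u w :: "'f ^ 'n::finite"
  assumes w: "herm q w w = 0" and "b \<noteq> 0" "d \<noteq> 0"
  shows "rank_one_pert q c d w ** rank_one_pert q a b u =
      rank_one_pert q a b u ** rank_one_pert q c d w \<longleftrightarrow> herm q w u = 0"
proof
  assume eq: "rank_one_pert q c d w ** rank_one_pert q a b u =
      rank_one_pert q a b u ** rank_one_pert q c d w"
  have nth: "herm q u w * w $ i * (u $ j) ^ q = herm q w u * u $ i * (w $ j) ^ q" for i j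
  proof -
    have "b * d * (herm q u w * w $ i * (u $ j) ^ q) = b * d * (herm q w u * u $ i * (w $ j) ^ q)"
      using arg_cong[OF eq, of "\<lambda>A. A $ i $ j"]
      by (simp add: rank_one_pert_mult_nth algebra_simps split: if_splits)
    then show ?thesis using assms(2,3) by simp
  qed
  have "herm q u w * w $ i * herm q w u = herm q w u * u $ i * herm q w w" for i
  proof -
    have "herm q u w * w $ i * herm q w u = (\<Sum>j\<in>UNIV. herm q u w * w $ i * (u $ j) ^ q * w $ j)"
      by (simp add: herm_def[of q w u] sum_distrib_left mult_ac)
    also have "\<dots> = (\<Sum>j\<in>UNIV. herm q w u * u $ i * (w $ j) ^ q * w $ j)"
      by (simp only: nth)
    also have "\<dots> = herm q w u * u $ i * herm q w w"
      by (simp add: herm_def[of q w w] sum_distrib_left mult_ac)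
    finally show ?thesis .
  qed
  then have "herm q u w * herm q w u = 0 \<or> w = 0"
    using w by (auto simp: vec_eq_iff)
  then show "herm q w u = 0"
    using herm_swap[of w u] q_pos by (auto simp: herm_def[of q 0])
next
  assume "herm q w u = 0"
  moreover from this have "herm q u w = 0"
    using herm_swap[of u w] q_pos by simp
  ultimately show "rank_one_pert q c d w ** rank_one_pert q a b u =
      rank_one_pert q a b u ** rank_one_pert q c d w"
    by (simp add: vec_eq_iff rank_one_pert_mult_nth algebra_simps)
qed

definition transvection :: "'f ^ 'n \<Rightarrow> 'f ^ 'n ^ 'n" where
  "transvection w = rank_one_pert q 1 1 w"

text \<open>A homology in the sense of projective geometry: if \<open>u\<close> has norm 1, it is
  \<open>a\<close> on the complement of \<open>u\<close> and \<open>1 / a\<^sup>2\<close> on \<open>u\<close>, which makes the determinant 1 in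
  dimension 3.\<close>

definition homology :: "'f \<Rightarrow> 'f ^ 'n \<Rightarrow> 'f ^ 'n ^ 'n" where
  "homology a u = rank_one_pert q a (1 / a\<^sup>2 - a) u"

lemma transvection_square:
  fixes w :: "'f ^ 'n::finite"
  assumes "(2 :: 'f) = 0" "herm q w w = 0"
  shows "transvection w ** transvection w = mat 1"
  using assms by (simp add: transvection_def rank_one_pert_mult rank_one_pert_one)

lemma transvection_in_SU:
  fixes w :: "'f ^ 3"
  assumes "(2 :: 'f) = 0" "herm q w w = 0"
  shows "transvection w \<in> carrier (SU q)"
  using transvection_square[OF assms] assms(2)
  by (simp add: SU_def transvection_def conj_transpose_rank_one_pert det_rank_one_pert)

lemma homology_mult:
  fixes u :: "'f ^ 'n::finite"
  assumes "herm q u u = 1" "a \<noteq> 0" "b \<noteq> 0"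
  shows "homology a u ** homology b u = homology (a * b) u"
proof -
  have "a * (1 / b\<^sup>2 - b) + (1 / a\<^sup>2 - a) * b + (1 / a\<^sup>2 - a) * (1 / b\<^sup>2 - b) = 1 / (a * b)\<^sup>2 - a * b"
    by (simp add: algebra_simps)
  then show ?thesis
    by (simp add: homology_def rank_one_pert_mult assms(1))
qed

lemma homology_one: "homology 1 u = mat 1"
  by (simp add: homology_def rank_one_pert_one)

lemma homology_in_SU:
  fixes u :: "'f ^ 3"
  assumes "herm q u u = 1" "a ^ (q + 1) = 1"
  shows "homology a u \<in> carrier (SU q)"
proof -
  have a: "a \<noteq> 0" using assms(2) by auto
  have "conj_transpose q (homology a u) = homology (a ^ q) u"
    by (simp add: homology_def conj_transpose_rank_one_pert power_diff power_divide
        flip: power_mult) (simp add: mult.commute)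
  then have "homology a u ** conj_transpose q (homology a u) = mat 1"
    using assms a by (simp add: homology_mult homology_one)
  moreover have "det (homology a u) = 1"
    using a assms(1) by (simp add: homology_def det_rank_one_pert)
  ultimately show ?thesis by (simp add: SU_def)
qed

lemma homology_power:
  fixes u :: "'f ^ 'n::finite"
  assumes "herm q u u = 1" "a \<noteq> 0"
  shows "homology a u [^]\<^bsub>SU q\<^esub> (k::nat) = homology (a ^ k) u"
proof (induction k)
  case 0
  then show ?case by (simp add: homology_one) (simp add: SU_def)
next
  case (Suc k)
  then show ?case
    using assms by (simp add: homology_mult SU_def mult.commute)
qed

text \<open>The three isotropic points are chosen on the sides of the coordinate triangle, two of them
  on the same side; since \<open>a\<close> has norm 1 and \<open>a \<noteq> 1\<close>, it can serve both as a coordinate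
  that separates these two and as the eigenvalue of the homologies.\<close>

lemma PSU_3_not_chordal:
  fixes a :: 'f
  assumes char: "(2 :: 'f) = 0" and "even q" and a: "a ^ (q + 1) = 1" "a ^ 3 \<noteq> 1"
  shows "\<not> chordal (power_graph (PSU q :: ('f ^ 3 ^ 3) set monoid))"
proof -
  interpret group "SU q :: ('f ^ 3 ^ 3) monoid" by (rule group_SU)
  \<comment> \<open>\<open>u i\<close> spans the orthogonal complement of the two vectors \<open>w j\<close> with \<open>j \<noteq> i\<close>.\<close>
  define w :: "nat \<Rightarrow> 'f ^ 3" where "w i = [vector [1, 1, 0], vector [1, a, 0], vector [1, 0, 1]] ! i" for i
  define u :: "nat \<Rightarrow> 'f ^ 3" where "u i = [vector [1, a, 1], vector [1, 1, 1], vector [0, 0, 1]] ! i" for i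
  have three: "i < 3 \<longleftrightarrow> i = 0 \<or> i = 1 \<or> i = 2" for i :: nat by auto
  have two: "(1 :: 'f) + 1 = 0" using char by simp
  have aq: "a * a ^ q = 1" using a by simp
  have a0: "a \<noteq> 0" and a1: "a \<noteq> 1" using a by auto
  have ww: "herm q (w i) (w i) = 0" if "i < 3" for i
    using that q_pos aq two by (auto simp: three w_def herm_def sum_3)
  have uu: "herm q (u i) (u i) = 1" if "i < 3" for i
    using that q_pos aq two by (auto simp: three u_def herm_def sum_3 add.assoc)
  have neg: "- x = x" for x :: 'f
    using char by (metis add_eq_0_iff mult_2 mult_zero_left)
  have aq1: "1 + a ^ q \<noteq> 0" "1 + a \<noteq> 0"
    using aq a1 neg[of 1] by (metis add_eq_0_iff mult.right_neutral)+
  have wu: "herm q (w i) (u j) = 0 \<longleftrightarrow> i \<noteq> j" if "i < 3" "j < 3" for i j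
    using that aq two aq1 by (auto simp: three w_def u_def herm_def sum_3 zero_power[OF q_pos])
  have b: "1 / a\<^sup>2 - a \<noteq> 0"
    using a0 a(2) by (simp add: divide_eq_eq power2_eq_square power3_eq_cube mult.assoc)
  show ?thesis
    unfolding PSU_def
  proof (rule power_graph_mod_center_not_chordal)
    show "coprime 2 (q + 1)" using \<open>even q\<close> by simp
    fix i :: nat assume i: "i < 3"
    show "transvection (w i) \<in> carrier (SU q)"
      using transvection_in_SU[OF char ww[OF i]] .
    show "homology a (u i) \<in> carrier (SU q)"
      using homology_in_SU[OF uu[OF i] a(1)] .
    show "transvection (w i) [^]\<^bsub>SU q\<^esub> (2::nat) = \<one>\<^bsub>SU q\<^esub>"
      using transvection_square[OF char ww[OF i]] by (simp add: numeral_2_eq_2) (simp add: SU_def)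
    show "homology a (u i) [^]\<^bsub>SU q\<^esub> (q + 1) = \<one>\<^bsub>SU q\<^esub>"
      by (simp only: homology_power[OF uu[OF i] a0] a(1) homology_one) (simp add: SU_def)
  next
    fix i j :: nat assume "i < 3" "j < 3"
    then show "transvection (w i) \<otimes>\<^bsub>SU q\<^esub> homology a (u j) = homology a (u j) \<otimes>\<^bsub>SU q\<^esub> transvection (w i)
      \<longleftrightarrow> i \<noteq> j"
      using rank_one_pert_commute_iff[OF ww b, of i 1] wu
      by (simp add: SU_def transvection_def homology_def)
  qed simp_all
qed

end

section \<open>Finite fields of even order\<close>

text \<open>Multiplication by \<open>x\<close> permutes the non-zero elements and hence fixes their product.\<close>

lemma finite_field_power_card_minus_one:
  fixes x :: "'f::{field,finite}"
  assumes "x \<noteq> 0"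
  shows "x ^ (CARD('f) - 1) = 1"
proof -
  have "(\<Prod>y\<in>UNIV-{0}. y) = (\<Prod>y\<in>UNIV-{0}. x * y)"
    by (rule prod.reindex_bij_witness[of _ "\<lambda>y. x * y" "\<lambda>y. y / x"]) (use assms in auto)
  also have "\<dots> = x ^ (CARD('f) - 1) * (\<Prod>y\<in>UNIV-{0}. y)"
    by (simp add: prod.distrib)
  finally show ?thesis by simp
qed

lemma finite_field_nontrivial_power:
  assumes "0 < n" "n < CARD('f) - 1"
  obtains x :: "'f::{field,finite}" where "x \<noteq> 0" "x ^ n \<noteq> 1"
proof -
  have "\<exists>x::'f. x \<noteq> 0 \<and> x ^ n \<noteq> 1"
  proof (rule ccontr)
    assume "\<not> ?thesis"
    then have *: "UNIV - {0} \<subseteq> {x::'f. poly (Polynomial.monom 1 n - 1) x = 0}"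
      by (auto simp: poly_monom)
    have p: "degree (Polynomial.monom 1 n - 1 :: 'f poly) = n"
      using assms by (subst diff_conv_add_uminus, subst degree_add_eq_left) (auto simp: degree_monom_eq)
    then have "(Polynomial.monom 1 n - 1 :: 'f poly) \<noteq> 0"
      using assms by auto
    then have "card (UNIV - {0::'f}) \<le> n"
      using card_poly_roots_bound[of "Polynomial.monom 1 n - 1 :: 'f poly"] card_mono[OF _ *] p by auto
    then show False using assms by (simp add: card_Diff_singleton)
  qed
  then show ?thesis using that by blast
qed

lemma CHAR_eq_2_if_card_power_of_2:
  assumes "CARD('f::{field,finite}) = 2 ^ k"
  shows "CHAR('f) = 2"
proof -
  have "prime CHAR('f)"
    by (intro prime_CHAR_semidom finite_imp_CHAR_pos) simp
  moreover have "CHAR('f) dvd 2 ^ k"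
    using CHAR_dvd_CARD[where 'a = 'f] assms by simp
  ultimately show ?thesis
    by (metis prime_dvd_power primes_dvd_imp_eq two_is_prime_nat)
qed

theorem theorem5p3:
  fixes q :: nat
  assumes "\<exists>k::nat. q = 2 ^ k" and "q \<ge> 4"
    and "CARD('f::{field,finite}) = q\<^sup>2"
  shows "\<not> chordal (power_graph (PSU q :: ('f ^ 3 ^ 3) set monoid))"
proof -
  obtain k where k: "q = 2 ^ k" using assms(1) by blast
  have char: "CHAR('f) = 2"
    by (rule CHAR_eq_2_if_card_power_of_2[of "k * 2"]) (simp add: assms(3) k power_mult)
  have fermat: "x ^ (q\<^sup>2 - 1) = 1" if "x \<noteq> 0" for x :: 'f
    using finite_field_power_card_minus_one[OF that] assms(3) by simp
  interpret unitary_field q "TYPE('f)"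
  proof
    fix x y :: 'f
    show "(x + y) ^ q = x ^ q + y ^ q"
      by (rule freshmans_dream'[of q k]) (simp_all add: char k)
    show "(x ^ q) ^ q = x"
    proof (cases "x = 0")
      case False
      have "(x ^ q) ^ q = x * x ^ (q\<^sup>2 - 1)"
        using assms(2) by (simp flip: power_mult power_Suc add: power2_eq_square)
      then show ?thesis using fermat[OF False] by simp
    qed (use assms(2) in simp)
  qed
  \<comment> \<open>The \<open>(q - 1)\<close>-th powers have norm 1; not all of them are cube roots of unity, because
    \<open>3 (q - 1)\<close> is smaller than the order \<open>(q - 1) (q + 1)\<close> of the multiplicative group.\<close>
  have sq: "(q - 1) * (q + 1) = q\<^sup>2 - 1"
    by (simp add: algebra_simps power2_eq_square)
  have "(q - 1) * 3 < (q - 1) * (q + 1)"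
    using assms(2) by (intro mult_strict_left_mono) auto
  then obtain x :: 'f where x: "x \<noteq> 0" "x ^ ((q - 1) * 3) \<noteq> 1"
    using finite_field_nontrivial_power[of "(q - 1) * 3", where 'f = 'f] assms sq by auto
  show ?thesis
  proof (rule PSU_3_not_chordal)
    show "(2 :: 'f) = 0" using of_nat_CHAR[where 'a = 'f] char by simp
    show "even q" using k assms(2) by (cases k) auto
    show "(x ^ (q - 1)) ^ (q + 1) = 1" using fermat[OF x(1)] sq by (metis power_mult)
    show "(x ^ (q - 1)) ^ 3 \<noteq> 1" using x(2) by (simp add: power_mult)
  qed
qed

end
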